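(* Let $d\ge3$, let $a>1$ be a real number with $2a^{d-1}-a^d-1>0$, and let $(\alpha_1,\ldots,\alpha_d)\in\mathfrak{C}(a)$ be such that the rotation $T(x_1,\ldots,x_d)=(x_1+\alpha_1,\ldots,x_d+\alpha_d)$ on $\mathbb{T}^d$ is minimal. Let $q_n^{(j)}$ denote the $n$-th continued fraction denominator of $\alpha_j$, and for $1\le j\le d$ set $$F^{(j)}=\bigcap_{n=1}^{\infty}\bigcup_{l=0}^{q^{(j)}_n-1}\left(\frac{l}{q^{(j)}_n}+\left[-\frac{1}{\sqrt{q^{(j)}_{n}q^{(j)}_{n+1}}},\frac{1}{\sqrt{q^{(j)}_{n}q^{(j)}_{n+1}}}\right]\right)\subset\mathbb{T}.$$ Then for every $1\le j\le d$ we have $\dim_H F^{(j)}\ge\frac{1}{1+a^d}$; in particular $\dim_H(F^{(1)}\times\cdots\times F^{(d)})\ge\frac{d}{1+a^d}$.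
   Context: $\mathbb{T}=\mathbb{R}/\mathbb{Z}$; $\dim_H$ is Hausdorff dimension. For irrational $\alpha=[0;a_1,a_2,\ldots]$ the denominators are $q_{-1}=0$, $q_0=1$, $q_n=a_nq_{n-1}+q_{n-2}$ for $n\ge 1$. With $C=2\lceil 4^{a+2}\rceil$, $\mathfrak{C}(a)$ is the set of $(\alpha_1,\ldots,\alpha_d)\in\mathbb{T}^d$ with all $\alpha_j$ irrational and $4(q_n^{(j)})^a\le q_n^{(j+1)}\le C(q_n^{(j)})^a$ for all $1\le j\le d$ and $n\ge1$, where $q_n^{(d+1)}:=q_{n+1}^{(1)}$. *)

theory Defs
  imports "HOL-Analysis.Analysis"
begin

section \<open>The circle \<open>\<real>/\<int>\<close>\<close>

quotient_type circle = real / "\<lambda>x y :: real. x - y \<in> \<int>"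
proof (rule equivpI)
  show "reflp (\<lambda>x y :: real. x - y \<in> \<int>)"
    by (simp add: reflp_def)
  show "symp (\<lambda>x y :: real. x - y \<in> \<int>)"
    unfolding symp_def by (metis Ints_minus minus_diff_eq)
  show "transp (\<lambda>x y :: real. x - y \<in> \<int>)"
    unfolding transp_def by (metis Ints_add diff_add_cancel add_diff_eq)
qed

lift_definition to_circle :: "real \<Rightarrow> circle" is "\<lambda>x. x" .

text \<open>The representative of a point of the circle in \<open>[0,1)\<close>.\<close>

lift_definition circle_rep :: "circle \<Rightarrow> real" is frac
proof -
  fix x y :: real
  assume "x - y \<in> \<int>"
  then obtain k where "x = y + of_int k"
    by (metis Ints_cases add.commute diff_add_cancel)
  then show "frac x = frac y"
    by (simp add: frac_def)
qed

instantiation circle :: ab_group_add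
begin

lift_definition zero_circle :: circle is "0 :: real" .

lift_definition plus_circle :: "circle \<Rightarrow> circle \<Rightarrow> circle" is "(+) :: real \<Rightarrow> real \<Rightarrow> real"
  by (metis Ints_add add_diff_add)

lift_definition uminus_circle :: "circle \<Rightarrow> circle" is "uminus :: real \<Rightarrow> real"
  by (metis Ints_minus minus_diff_minus)

lift_definition minus_circle :: "circle \<Rightarrow> circle \<Rightarrow> circle" is "(-) :: real \<Rightarrow> real \<Rightarrow> real"
  by (metis Ints_diff diff_diff_eq2 diff_add_eq add_diff_eq diff_diff_eq add.commute)

instance
  by standard (transfer; simp add: algebra_simps)+

end

lemma infdist_Ints_attained:
  fixes x :: real
  obtains k :: int where "infdist x \<int> = \<bar>x - of_int k\<bar>"
proof -
  obtain z :: real where "z \<in> \<int>" "infdist x \<int> = dist x z"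
    using infdist_attains_inf[of "\<int> :: real set" x] closed_Ints Ints_0 by blast
  then show ?thesis
    using that by (auto simp: dist_real_def elim!: Ints_cases)
qed

lemma infdist_Ints_le:
  fixes x :: real
  shows "infdist x \<int> \<le> \<bar>x - of_int k\<bar>"
  using infdist_le[of "of_int k :: real" \<int> x] by (simp add: dist_real_def)

lemma infdist_Ints_minus_le: "infdist (- x :: real) \<int> \<le> infdist x \<int>"
proof -
  obtain k where "infdist x \<int> = \<bar>x - of_int k\<bar>"
    by (rule infdist_Ints_attained)
  then show ?thesis
    using infdist_Ints_le[of "-x" "-k"] by simp
qed

lemma infdist_Ints_add_le: "infdist (x + y :: real) \<int> \<le> infdist x \<int> + infdist y \<int>"
proof -
  obtain k l where "infdist x \<int> = \<bar>x - of_int k\<bar>" "infdist y \<int> = \<bar>y - of_int l\<bar>"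
    by (meson infdist_Ints_attained)
  then show ?thesis
    using infdist_Ints_le[of "x + y" "k + l"] by simp
qed

lemma infdist_Ints_eq_0_iff: "infdist (x :: real) \<int> = 0 \<longleftrightarrow> x \<in> \<int>"
  using in_closed_iff_infdist_zero[of "\<int> :: real set" x] closed_Ints Ints_0 by blast

text \<open>The quotient metric \<open>\<parallel>x - y\<parallel>\<close>, the distance of \<open>x - y\<close> to the nearest integer.\<close>

instantiation circle :: metric_space
begin

lift_definition dist_circle :: "circle \<Rightarrow> circle \<Rightarrow> real" is "\<lambda>x y :: real. infdist (x - y) \<int>"
proof -
  fix x x' y y' :: real
  assume "x - x' \<in> \<int>" "y - y' \<in> \<int>"
  then have *: "infdist ((x - x') - (y - y')) \<int> = 0" "infdist ((y - y') - (x - x')) \<int> = 0"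
    by (simp_all add: infdist_Ints_eq_0_iff)
  have "infdist (x - y) \<int> \<le> infdist (x' - y') \<int>"
    using infdist_Ints_add_le[of "x' - y'" "(x - x') - (y - y')"] *(1) by (simp add: algebra_simps)
  moreover have "infdist (x' - y') \<int> \<le> infdist (x - y) \<int>"
    using infdist_Ints_add_le[of "x - y" "(y - y') - (x - x')"] *(2) by (simp add: algebra_simps)
  ultimately show "infdist (x - y) \<int> = infdist (x' - y') \<int>"
    by simp
qed

definition uniformity_circle :: "(circle \<times> circle) filter"
  where "uniformity_circle = (INF e\<in>{0 <..}. principal {(x, y). dist x y < e})"

definition open_circle :: "circle set \<Rightarrow> bool"
  where "open_circle U \<longleftrightarrow> (\<forall>x\<in>U. eventually (\<lambda>(x', y). x' = x \<longrightarrow> y \<in> U) uniformity)"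

instance
proof
  fix x y z :: circle
  show "dist x y = 0 \<longleftrightarrow> x = y"
    by transfer (rule infdist_Ints_eq_0_iff)
  show "dist x y \<le> dist x z + dist y z"
  proof transfer
    fix x y z :: real
    show "infdist (x - y) \<int> \<le> infdist (x - z) \<int> + infdist (y - z) \<int>"
      using infdist_Ints_add_le[of "x - z" "z - y"] infdist_Ints_minus_le[of "y - z"] by simp
  qed
qed (simp_all only: uniformity_circle_def open_circle_def)

end

section \<open>The torus \<open>(\<real>/\<int>)\<^sup>d\<close>\<close>

text \<open>Points are functions on \<open>{1..d}\<close>, extended by \<^term>\<open>undefined\<close> elsewhere.\<close>

definition torus :: "nat \<Rightarrow> (nat \<Rightarrow> circle) set"
  where "torus d = (\<Pi>\<^sub>E j\<in>{1..d}. UNIV)"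

definition torus_dist :: "nat \<Rightarrow> (nat \<Rightarrow> circle) \<Rightarrow> (nat \<Rightarrow> circle) \<Rightarrow> real"
  where "torus_dist d x y = L2_set (\<lambda>j. dist (x j) (y j)) {1..d}"

lemma Metric_space_torus: "Metric_space (torus d) (torus_dist d)"
proof
  fix x y z :: "nat \<Rightarrow> circle"
  show "0 \<le> torus_dist d x y"
    by (simp add: torus_dist_def)
  show "torus_dist d x y = torus_dist d y x"
    by (simp add: torus_dist_def dist_commute)
  assume x: "x \<in> torus d" and y: "y \<in> torus d"
  have "torus_dist d x y = 0 \<longleftrightarrow> (\<forall>j\<in>{1..d}. x j = y j)"
    by (simp add: torus_dist_def L2_set_eq_0_iff)
  also have "\<dots> \<longleftrightarrow> x = y"
    using x y unfolding torus_def by (metis PiE_ext)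
  finally show "torus_dist d x y = 0 \<longleftrightarrow> x = y" .
  have "torus_dist d x z \<le> L2_set (\<lambda>j. dist (x j) (y j) + dist (y j) (z j)) {1..d}"
    unfolding torus_dist_def by (intro L2_set_mono) (simp_all add: dist_triangle)
  also have "\<dots> \<le> torus_dist d x y + torus_dist d y z"
    unfolding torus_dist_def by (rule L2_set_triangle_ineq)
  finally show "torus_dist d x z \<le> torus_dist d x y + torus_dist d y z" .
qed

definition torus_metric :: "nat \<Rightarrow> (nat \<Rightarrow> circle) metric"
  where "torus_metric d = metric (torus d, torus_dist d)"

lemma mspace_torus_metric [simp]: "mspace (torus_metric d) = torus d"
  and mdist_torus_metric [simp]: "mdist (torus_metric d) = torus_dist d"
  by (simp_all add: torus_metric_def Metric_space.mspace_metric Metric_space.mdist_metric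
      Metric_space_torus)

definition torus_topology :: "nat \<Rightarrow> (nat \<Rightarrow> circle) topology"
  where "torus_topology d = product_topology (\<lambda>_. euclidean) {1..d}"

definition rotation :: "nat \<Rightarrow> (nat \<Rightarrow> circle) \<Rightarrow> (nat \<Rightarrow> circle) \<Rightarrow> (nat \<Rightarrow> circle)"
  where "rotation d \<alpha> x = (\<lambda>j\<in>{1..d}. x j + \<alpha> j)"

text \<open>A dynamical system is minimal if it has no proper nonempty closed forward-invariant subset;
  for continuous maps of compact spaces this says that every forward orbit is dense.\<close>

definition minimal_map :: "'a topology \<Rightarrow> ('a \<Rightarrow> 'a) \<Rightarrow> bool"
  where "minimal_map X T \<longleftrightarrow> (\<forall>A. closedin X A \<and> T ` A \<subseteq> A \<longrightarrow> A = {} \<or> A = topspace X)"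

section \<open>Hausdorff dimension\<close>

definition ediam :: "'a metric \<Rightarrow> 'a set \<Rightarrow> ennreal"
  where "ediam m U = (SUP x\<in>U. SUP y\<in>U. ennreal (mdist m x y))"

text \<open>
  The summand \<open>(diam U)\<^sup>s\<close>, with the conventions \<open>0\<^sup>0 = 1\<close> for nonempty \<open>U\<close> (whereas
  \<open>0 powr 0 = 0\<close>) and \<open>0\<close> for \<open>U = {}\<close>. It is only used for sets of finite diameter.
\<close>

definition diam_powr :: "'a metric \<Rightarrow> real \<Rightarrow> 'a set \<Rightarrow> ennreal"
  where "diam_powr m s U =
    (if U = {} then 0 else if s = 0 then 1 else ennreal (enn2real (ediam m U) powr s))"

definition hausdorff_premeasure :: "'a metric \<Rightarrow> real \<Rightarrow> real \<Rightarrow> 'a set \<Rightarrow> ennreal"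
  where "hausdorff_premeasure m s \<delta> S =
    (INF U\<in>{U :: nat \<Rightarrow> 'a set. (\<forall>i. U i \<subseteq> mspace m \<and> ediam m (U i) \<le> ennreal \<delta>) \<and> S \<subseteq> (\<Union>i. U i)}.
       \<Sum>i. diam_powr m s (U i))"

definition hausdorff_measure :: "'a metric \<Rightarrow> real \<Rightarrow> 'a set \<Rightarrow> ennreal"
  where "hausdorff_measure m s S = (SUP \<delta>\<in>{0<..}. hausdorff_premeasure m s \<delta> S)"

definition hausdorff_dim :: "'a metric \<Rightarrow> 'a set \<Rightarrow> ennreal"
  where "hausdorff_dim m S = (INF s\<in>{s. 0 \<le> s \<and> hausdorff_measure m s S = 0}. ennreal s)"

section \<open>Continued fractions\<close>

definition gauss_map :: "real \<Rightarrow> real"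
  where "gauss_map x = frac (1 / x)"

text \<open>
  The partial quotient \<open>a\<^sub>n\<close>, for \<open>n \<ge> 1\<close>, of an irrational \<open>x = [0; a\<^sub>1, a\<^sub>2, \<dots>]\<close> in \<open>(0,1)\<close>:
  \<open>x = 1 / (a\<^sub>1 + gauss_map x)\<close> and so on.
\<close>

definition partial_quotient :: "real \<Rightarrow> nat \<Rightarrow> nat"
  where "partial_quotient x n = nat \<lfloor>1 / (gauss_map ^^ (n - 1)) x\<rfloor>"

text \<open>
  The convention \<open>q\<^sub>-\<^sub>1 = 0\<close> is built into the second equation.
\<close>

fun cf_denom :: "real \<Rightarrow> nat \<Rightarrow> nat" where
  "cf_denom x 0 = 1"
| "cf_denom x (Suc 0) = partial_quotient x 1"
| "cf_denom x (Suc (Suc n)) =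
     partial_quotient x (Suc (Suc n)) * cf_denom x (Suc n) + cf_denom x n"

definition denom :: "circle \<Rightarrow> nat \<Rightarrow> nat"
  where "denom \<alpha> n = cf_denom (circle_rep \<alpha>) n"

section \<open>The class \<open>\<CC>(a)\<close> and the sets \<open>F\<^sup>(\<^sup>j\<^sup>)\<close>\<close>

text \<open>
  \<open>q\<^sub>n\<^sup>(\<^sup>j\<^sup>)\<close> for \<open>1 \<le> j \<le> d + 1\<close>, where the index \<open>d + 1\<close> means
  \<open>q\<^sub>n\<^sup>(\<^sup>d\<^sup>+\<^sup>1\<^sup>) = q\<^sub>n\<^sub>+\<^sub>1\<^sup>(\<^sup>1\<^sup>)\<close>.
\<close>

definition cyclic_denom :: "nat \<Rightarrow> (nat \<Rightarrow> circle) \<Rightarrow> nat \<Rightarrow> nat \<Rightarrow> nat"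
  where "cyclic_denom d \<alpha> j n = (if j = d + 1 then denom (\<alpha> 1) (n + 1) else denom (\<alpha> j) n)"

definition frakC :: "nat \<Rightarrow> real \<Rightarrow> (nat \<Rightarrow> circle) set"
  where "frakC d a = {\<alpha> \<in> torus d.
    (\<forall>j\<in>{1..d}. circle_rep (\<alpha> j) \<notin> \<rat>) \<and>
    (\<forall>j\<in>{1..d}. \<forall>n\<ge>1.
       4 * real (cyclic_denom d \<alpha> j n) powr a \<le> real (cyclic_denom d \<alpha> (j + 1) n) \<and>
       real (cyclic_denom d \<alpha> (j + 1) n)
         \<le> 2 * real_of_int \<lceil>4 powr (a + 2)\<rceil> * real (cyclic_denom d \<alpha> j n) powr a)}"

definition F_set :: "circle \<Rightarrow> circle set"
  where "F_set \<alpha> = (\<Inter>n\<in>{1..}. \<Union>l\<in>{0..<denom \<alpha> n}.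
    let r = 1 / sqrt (real (denom \<alpha> n) * real (denom \<alpha> (n + 1)))
    in (\<lambda>t. to_circle (real l / real (denom \<alpha> n) + t)) ` {- r..r})"

end

theory Submission
  imports Defs
begin

text \<open>
  Write \<open>q n\<close> for the denominators of one coordinate and \<open>\<tau> = a ^ d\<close>, so that \<open>q (n + 1)\<close> is
  comparable to \<open>q n powr \<tau>\<close>. An interval of generation \<open>n\<close> has radius
  \<open>r n = 1 / sqrt (q n * q (n + 1))\<close>, much larger than the spacing \<open>1 / q (n + 1)\<close> of the next
  generation, and so contains about \<open>sqrt (q (n + 1) / q n)\<close> intervals of it. The product of these
  numbers telescopes: there are about \<open>sqrt (q n)\<close> intervals of generation \<open>n\<close>, against a radius
  of about \<open>q n powr (- (1 + \<tau>) / 2)\<close>, whence the exponent \<open>1 / (1 + \<tau>)\<close>.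

  Instead of a Frostman measure we use a parametrisation \<open>\<psi>\<close> of a subset of \<open>F\<close> by \<open>{0..<1}\<close> that
  satisfies \<open>\<bar>u - v\<bar> \<le> C * dist (\<psi> u) (\<psi> v) powr s\<close> for a given \<open>s < 1 / (1 + \<tau>)\<close>.
  A cover of \<open>F\<close> pulls back to a cover of the unit interval, and products of such maps pull a cover
  of the product set back to a cover of the unit cube, so Lebesgue measure bounds the sums
  in the Hausdorff measure from below.
\<close>

section \<open>Lower bounds for the Hausdorff dimension\<close>

lemma mdist_le_ediam:
  assumes "x \<in> U" "y \<in> U" "ediam m U \<le> ennreal \<delta>"
  shows "mdist m x y \<le> enn2real (ediam m U)"
proof -
  have "ennreal (mdist m x y) \<le> ediam m U"
    unfolding ediam_def by (rule SUP_upper2[OF assms(1)], rule SUP_upper2[OF assms(2)]) simp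
  moreover have "ediam m U < top"
    using assms(3) by (metis ennreal_less_top le_less_trans)
  ultimately show ?thesis
    by (metis enn2real_ennreal enn2real_mono mdist_nonneg)
qed

lemma emeasure_PiM_cube:
  assumes "finite I" "x \<le> y"
  shows "emeasure (PiM I (\<lambda>_. lborel :: real measure)) (\<Pi>\<^sub>E i\<in>I. {f i + x..f i + y})
    = ennreal ((y - x) ^ card I)"
proof -
  interpret product_sigma_finite "\<lambda>_. lborel :: real measure"
    by standard
  show ?thesis
    using assms by (subst emeasure_PiM) (auto simp: ennreal_power)
qed

text \<open>The part of the cube that \<open>\<psi>\<close> sends into a set of diameter
  \<open>D\<close> lies in a box of side \<open>2 * C * D powr s\<close>. For
  \<open>D \<le> 1\<close> its volume is at most \<open>K\<close> times the summand of exponent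
  \<open>t\<close>, and the boxes coming from a cover have total volume at least 1.\<close>

lemma hausdorff_measure_nonzero:
  fixes \<psi> :: "('i \<Rightarrow> real) \<Rightarrow> 'a" and C s t :: real
  assumes I: "finite I"
    and \<psi>: "\<And>u. u \<in> (\<Pi>\<^sub>E i\<in>I. {0..<1}) \<Longrightarrow> \<psi> u \<in> S"
    and C: "C > 0" and s: "s > 0"
    and holder: "\<And>u v i. u \<in> (\<Pi>\<^sub>E i\<in>I. {0..<1}) \<Longrightarrow> v \<in> (\<Pi>\<^sub>E i\<in>I. {0..<1}) \<Longrightarrow> i \<in> I \<Longrightarrow>
      \<bar>u i - v i\<bar> \<le> C * mdist m (\<psi> u) (\<psi> v) powr s"
    and t: "0 \<le> t" "t \<le> card I * s"
  shows "hausdorff_measure m t S \<noteq> 0"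
proof -
  let ?M = "PiM I (\<lambda>_. lborel :: real measure)"
  let ?box = "\<Pi>\<^sub>E i\<in>I. {0..<1::real}"
  define K where "K = (2 * C) ^ card I"
  have K: "K > 0"
    using C by (simp add: K_def)
  have cover: "1 \<le> ennreal K * (\<Sum>i. diam_powr m t (U i))"
    if U: "\<And>i. ediam m (U i) \<le> ennreal 1" "S \<subseteq> (\<Union>i. U i)" for U :: "nat \<Rightarrow> 'a set"
  proof -
    \<comment> \<open>The preimage of \<open>U k\<close> need not be measurable, so a measurable set
      around it takes its place.\<close>
    have "\<exists>B. B \<in> sets ?M \<and> {u \<in> ?box. \<psi> u \<in> U k} \<subseteq> B \<and>
      emeasure ?M B \<le> ennreal K * diam_powr m t (U k)" for k
    proof (cases "{u \<in> ?box. \<psi> u \<in> U k} = {}")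
      case True
      show ?thesis
        unfolding True by (rule exI[of _ "{}"]) auto
    next
      case False
      then obtain u0 where u0: "u0 \<in> ?box" "\<psi> u0 \<in> U k"
        by blast
      define D where "D = enn2real (ediam m (U k))"
      define L where "L = C * D powr s"
      define B where "B = (\<Pi>\<^sub>E i\<in>I. {u0 i + - L..u0 i + L})"
      have D1: "D \<le> 1"
        unfolding D_def using enn2real_mono[OF U(1)[of k]] by simp
      have D0: "D \<ge> 0"
        by (simp add: D_def)
      have L: "L \<ge> 0"
        using C by (simp add: L_def)
      have near: "u i \<in> {u0 i + - L..u0 i + L}" if u: "u \<in> ?box" "\<psi> u \<in> U k" and i: "i \<in> I" for u i
      proof -
        have "mdist m (\<psi> u) (\<psi> u0) \<le> D"
          unfolding D_def by (rule mdist_le_ediam[OF u(2) u0(2) U(1)])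
        then have "C * mdist m (\<psi> u) (\<psi> u0) powr s \<le> L"
          unfolding L_def using C s by (intro mult_left_mono powr_mono2) auto
        then show ?thesis
          using holder[OF u(1) u0(1) i] by (simp add: abs_le_iff)
      qed
      have subset: "{u \<in> ?box. \<psi> u \<in> U k} \<subseteq> B"
      proof
        fix u
        assume u: "u \<in> {u \<in> ?box. \<psi> u \<in> U k}"
        then have "u \<in> extensional I"
          by (simp add: PiE_def)
        then show "u \<in> B"
          unfolding B_def PiE_iff using near u by blast
      qed
      have sets: "B \<in> sets ?M"
        unfolding B_def using I by (intro sets_PiM_I_finite) auto
      have "emeasure ?M B = ennreal ((2 * L) ^ card I)"
        unfolding B_def using emeasure_PiM_cube[OF I, of "- L" L u0] L by simp
      also have "\<dots> \<le> ennreal K * diam_powr m t (U k)"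
      proof -
        have "(2 * L) ^ card I = K * (D powr s) ^ card I"
          by (simp add: L_def K_def power_mult_distrib)
        moreover have "ennreal ((D powr s) ^ card I) \<le> diam_powr m t (U k)"
        proof (cases "t = 0")
          case True
          have "(D powr s) ^ card I \<le> 1"
            using D0 D1 s by (intro power_le_one powr_le1) auto
          then show ?thesis
            using True u0(2) by (auto simp: diam_powr_def)
        next
          case False
          have "(D powr s) ^ card I \<le> D powr t"
          proof (cases "D = 0")
            case True
            \<comment> \<open>Over an empty index set the left side would be the empty product 1,
              against \<open>0 powr t = 0\<close>.\<close>
            have "card I \<noteq> 0"
              using False t by (metis of_nat_0 mult_zero_left order_antisym)
            then show ?thesis
              using True by (simp add: zero_power)
          next
            case D: False
            have "(D powr s) ^ card I = D powr (card I * s)"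
              using D D0 by (simp add: powr_power mult.commute)
            also have "\<dots> \<le> D powr t"
              using t D0 D1 D by (intro powr_mono') auto
            finally show ?thesis .
          qed
          then show ?thesis
            using False u0(2) by (auto simp: diam_powr_def D_def intro: ennreal_leI)
        qed
        ultimately show ?thesis
          using K by (simp add: ennreal_mult mult_left_mono)
      qed
      finally show ?thesis
        using subset sets by (intro exI[of _ B] conjI)
    qed
    then have "\<exists>B. \<forall>k. B k \<in> sets ?M \<and> {u \<in> ?box. \<psi> u \<in> U k} \<subseteq> B k \<and>
      emeasure ?M (B k) \<le> ennreal K * diam_powr m t (U k)"
      by (intro choice allI)
    then obtain B where B: "\<And>k. B k \<in> sets ?M" "\<And>k. {u \<in> ?box. \<psi> u \<in> U k} \<subseteq> B k"
      "\<And>k. emeasure ?M (B k) \<le> ennreal K * diam_powr m t (U k)"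
      by blast
    interpret product_sigma_finite "\<lambda>_. lborel :: real measure"
      by standard
    have "1 = emeasure ?M ?box"
      using I by (subst emeasure_PiM) auto
    also have "\<dots> \<le> emeasure ?M (\<Union>k. B k)"
    proof (rule emeasure_mono)
      show "?box \<subseteq> (\<Union>k. B k)"
      proof
        fix u
        assume u: "u \<in> ?box"
        then obtain k where "\<psi> u \<in> U k"
          using U(2) \<psi>[OF u] by blast
        then show "u \<in> (\<Union>k. B k)"
          using B(2)[of k] u by blast
      qed
    qed (use B(1) in auto)
    also have "\<dots> \<le> (\<Sum>k. emeasure ?M (B k))"
      using B(1) by (intro emeasure_subadditive_countably) auto
    also have "\<dots> \<le> (\<Sum>k. ennreal K * diam_powr m t (U k))"
      by (intro suminf_le B(3)) auto
    finally show ?thesis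
      by simp
  qed
  \<comment> \<open>One mesh is enough, as the measure is a supremum over meshes; mesh 1 provides
    \<open>D \<le> 1\<close>.\<close>
  have "ennreal (1 / K) \<le> hausdorff_premeasure m t 1 S"
    unfolding hausdorff_premeasure_def
  proof (rule INF_greatest)
    fix U :: "nat \<Rightarrow> 'a set"
    assume U: "U \<in> {U. (\<forall>i. U i \<subseteq> mspace m \<and> ediam m (U i) \<le> ennreal 1) \<and> S \<subseteq> (\<Union>i. U i)}"
    have "ennreal (1 / K) * 1 \<le> ennreal (1 / K) * (ennreal K * (\<Sum>i. diam_powr m t (U i)))"
      by (intro mult_left_mono cover) (use U in auto)
    also have "\<dots> = (\<Sum>i. diam_powr m t (U i))"
      using K by (simp flip: mult.assoc ennreal_mult)
    finally show "ennreal (1 / K) \<le> (\<Sum>i. diam_powr m t (U i))"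
      by simp
  qed
  also have "\<dots> \<le> hausdorff_measure m t S"
    unfolding hausdorff_measure_def by (rule SUP_upper) simp
  finally show ?thesis
    using K by auto
qed

lemma hausdorff_dim_ge:
  fixes \<psi> :: "('i \<Rightarrow> real) \<Rightarrow> 'a" and C s :: real
  assumes "finite I" "\<And>u. u \<in> (\<Pi>\<^sub>E i\<in>I. {0..<1}) \<Longrightarrow> \<psi> u \<in> S" "C > 0" "s > 0"
    and "\<And>u v i. u \<in> (\<Pi>\<^sub>E i\<in>I. {0..<1}) \<Longrightarrow> v \<in> (\<Pi>\<^sub>E i\<in>I. {0..<1}) \<Longrightarrow> i \<in> I \<Longrightarrow>
      \<bar>u i - v i\<bar> \<le> C * mdist m (\<psi> u) (\<psi> v) powr s"
  shows "hausdorff_dim m S \<ge> ennreal (card I * s)"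
  unfolding hausdorff_dim_def
proof (rule INF_greatest, rule ennreal_leI)
  fix t
  assume t: "t \<in> {t. 0 \<le> t \<and> hausdorff_measure m t S = 0}"
  show "card I * s \<le> t"
  proof (rule ccontr)
    assume "\<not> card I * s \<le> t"
    then have "0 \<le> t" "t \<le> card I * s"
      using t by simp_all
    then have "hausdorff_measure m t S \<noteq> 0"
      by (intro hausdorff_measure_nonzero[of I \<psi> S C s m t, OF assms])
    then show False
      using t by simp
  qed
qed

text \<open>The parametrisations are built for exponents strictly below \<open>s0\<close>, with
  constants that depend on the exponent; this lets the exponent tend to \<open>s0\<close>.\<close>

lemma ennreal_mult_le_of_less:
  assumes "s0 > 0" "\<And>s. 0 < s \<Longrightarrow> s < s0 \<Longrightarrow> ennreal (c * s) \<le> x" "c \<ge> 0"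
  shows "ennreal (c * s0) \<le> x"
proof (rule tendsto_upperbound)
  show "((\<lambda>s. ennreal (c * s)) \<longlongrightarrow> ennreal (c * s0)) (at_left s0)"
    by (intro tendsto_intros)
  show "\<forall>\<^sub>F s in at_left s0. ennreal (c * s) \<le> x"
    using eventually_at_left_real[OF assms(1)] by eventually_elim (use assms(2) in auto)
qed simp

section \<open>Points of the circle\<close>

lemma to_circle_eq_iff: "to_circle x = to_circle y \<longleftrightarrow> x - y \<in> \<int>"
  by transfer simp

lemma dist_to_circle:
  assumes "\<bar>x - y\<bar> \<le> 1 / 2"
  shows "dist (to_circle x) (to_circle y) = \<bar>x - y\<bar>"
proof -
  obtain k where k: "infdist (x - y) \<int> = \<bar>x - y - of_int k\<bar>"
    by (rule infdist_Ints_attained)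
  have "\<bar>x - y\<bar> \<le> \<bar>x - y - of_int k\<bar>"
  proof (cases "k = 0")
    case False
    then have "\<bar>real_of_int k\<bar> \<ge> 1"
      by linarith
    then show ?thesis
      using assms by linarith
  qed simp
  then have "infdist (x - y) \<int> = \<bar>x - y\<bar>"
    using k infdist_Ints_le[of "x - y" 0] by simp
  then show ?thesis
    by (simp add: dist_circle.abs_eq to_circle_def)
qed

lemma to_circle_in_F_set:
  assumes "\<And>n. n \<ge> 1 \<Longrightarrow> denom \<alpha> n > 0"
    and "\<And>n. n \<ge> 1 \<Longrightarrow> \<exists>p :: int. \<bar>x - p / denom \<alpha> n\<bar> \<le> 1 / sqrt (real (denom \<alpha> n) * real (denom \<alpha> (n + 1)))"
  shows "to_circle x \<in> F_set \<alpha>"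
  unfolding F_set_def Let_def
proof (intro INT_I)
  fix n :: nat
  assume "n \<in> {1..}"
  then have n: "n \<ge> 1"
    by simp
  let ?q = "denom \<alpha> n" and ?r = "1 / sqrt (real (denom \<alpha> n) * real (denom \<alpha> (n + 1)))"
  obtain p :: int where p: "\<bar>x - p / ?q\<bar> \<le> ?r"
    using assms(2)[OF n] by blast
  \<comment> \<open>\<open>F_set\<close> uses only numerators from 0 up to the denominator; passing
    to the residue moves the fraction by an integer, which is invisible on the circle.\<close>
  define l where "l = nat (p mod int ?q)"
  have q: "?q > 0"
    using assms(1)[OF n] .
  have l: "int l = p mod int ?q"
    using q by (simp add: l_def)
  have "l < ?q"
    using q l by (metis of_nat_0_less_iff of_nat_less_iff pos_mod_bound)
  moreover have "p = int ?q * (p div int ?q) + int l"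
    by (simp add: l)
  then have "real_of_int p = real ?q * of_int (p div int ?q) + real l"
    by (metis of_int_add of_int_mult of_int_of_nat_eq)
  then have "x - (l / ?q + (x - p / ?q)) = of_int (p div int ?q)"
    using q by (simp add: field_simps)
  then have "to_circle x = to_circle (l / ?q + (x - p / ?q))"
    unfolding to_circle_eq_iff by simp
  moreover have "x - p / ?q \<in> {- ?r..?r}"
    using p by (simp add: abs_le_iff)
  ultimately show "to_circle x \<in> (\<Union>l\<in>{0..<?q}. (\<lambda>t. to_circle (real l / real ?q + t)) ` {- ?r..?r})"
    by (intro UN_I[of l] image_eqI[of _ _ "x - p / ?q"]) auto
qed

section \<open>A Cantor set of approximable numbers\<close>

text \<open>If the unit interval starting at \<open>\<lfloor>x\<rfloor>\<close> is cut into
  \<open>m\<close> equal pieces, the difference is the index of the piece containing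
  \<open>x\<close>.\<close>

lemma floor_mult_digit:
  fixes m :: nat and x :: real
  assumes "m > 0"
  shows "0 \<le> \<lfloor>m * x\<rfloor> - m * \<lfloor>x\<rfloor>" "\<lfloor>m * x\<rfloor> - m * \<lfloor>x\<rfloor> < m"
proof -
  have "real m * of_int \<lfloor>x\<rfloor> \<le> m * x"
    by (intro mult_left_mono) auto
  then have "of_int (m * \<lfloor>x\<rfloor>) \<le> m * x"
    by simp
  then show "0 \<le> \<lfloor>m * x\<rfloor> - m * \<lfloor>x\<rfloor>"
    by (simp add: le_floor_iff)
  have "real m * x < real m * (of_int \<lfloor>x\<rfloor> + 1)"
    using assms by (intro mult_strict_left_mono) auto
  then have "m * x < of_int (m * \<lfloor>x\<rfloor> + m)"
    by (simp add: algebra_simps)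
  then show "\<lfloor>m * x\<rfloor> - m * \<lfloor>x\<rfloor> < m"
    by (simp add: floor_less_iff algebra_simps)
qed

text \<open>Assumption \<open>step\<close> is nesting of the intervals of radius \<open>r n\<close>
  about \<open>x n\<close>: left endpoints increase, right endpoints decrease, and every left
  endpoint is below every right one.\<close>

lemma nested_intervals_point:
  fixes x r :: "nat \<Rightarrow> real"
  assumes step: "\<And>n. \<bar>x (Suc n) - x n\<bar> \<le> r n - r (Suc n)" and r: "\<And>n. r n \<ge> 0"
  shows "\<bar>(SUP n. x n - r n) - x n\<bar> \<le> r n"
proof -
  have "x k - r k \<le> x (Suc k) - r (Suc k)" for k
    using step[of k] by linarith
  then have inc: "incseq (\<lambda>n. x n - r n)"
    by (rule incseq_SucI)
  have "x (Suc k) + r (Suc k) \<le> x k + r k" for k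
    using step[of k] by linarith
  then have dec: "decseq (\<lambda>n. x n + r n)"
    by (rule decseq_SucI)
  have le: "x k - r k \<le> x n + r n" for k n
  proof -
    have "x k - r k \<le> x (max k n) - r (max k n)"
      using inc by (auto simp: incseq_def)
    also have "\<dots> \<le> x (max k n) + r (max k n)"
      using r[of "max k n"] by linarith
    also have "\<dots> \<le> x n + r n"
      using dec by (auto simp: decseq_def)
    finally show ?thesis .
  qed
  have "x n - r n \<le> (SUP n. x n - r n)"
    by (rule cSUP_upper) (use le[of _ 0] in \<open>auto intro: bdd_aboveI[of _ "x 0 + r 0"]\<close>)
  moreover have "(SUP n. x n - r n) \<le> x n + r n"
    by (rule cSUP_least) (use le in auto)
  ultimately show ?thesis
    by linarith
qed

text \<open>
  Level \<open>n\<close> here is level \<open>n + 1\<close> of \<^const>\<open>F_set\<close>. An interval of level \<open>n\<close> receives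
  \<open>children n\<close> subintervals, centred at consecutive multiples of \<open>1 / q (n + 1)\<close> and selected by
  the digits of \<open>u\<close> in its Cantor series expansion with bases \<open>children 0, children 1, \<dots>\<close>;
  \<open>numer u n / q n\<close> is the centre of the interval of level \<open>n\<close> so obtained.
\<close>

locale denominator_sequence =
  fixes q :: "nat \<Rightarrow> nat"
  assumes q_0_pos: "q 0 > 0"
    and q_Suc_ge: "64 * q n \<le> q (Suc n)"
begin

definition radius :: "nat \<Rightarrow> real"
  where "radius n = 1 / sqrt (real (q n) * real (q (Suc n)))"

definition children :: "nat \<Rightarrow> nat"
  where "children n = nat \<lfloor>sqrt (q (Suc n) / q n) / 4\<rfloor>"

definition count :: "nat \<Rightarrow> nat"
  where "count n = (\<Prod>i<n. children i)"

primrec numer :: "real \<Rightarrow> nat \<Rightarrow> int"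
  where "numer u 0 = 0"
  | "numer u (Suc n) = \<lfloor>real (q (Suc n)) * (real_of_int (numer u n) / real (q n))\<rfloor>
      + (\<lfloor>real (count (Suc n)) * u\<rfloor> - int (children n) * \<lfloor>real (count n) * u\<rfloor>)"

definition point :: "real \<Rightarrow> real"
  where "point u = (SUP n. numer u n / q n - radius n)"

section \<open>Sizes of radii and numbers of subintervals\<close>

lemma q_pos: "q n > 0"
proof (induction n)
  case (Suc n)
  then show ?case
    using q_Suc_ge[of n] by linarith
qed (rule q_0_pos)

lemma sqrt_ratio_ge: "sqrt (q (Suc n) / q n) \<ge> 8"
proof (rule real_le_rsqrt)
  have "real (64 * q n) \<le> q (Suc n)"
    using q_Suc_ge by (rule of_nat_mono)
  then show "8\<^sup>2 \<le> real (q (Suc n)) / q n"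
    using q_pos[of n] by (simp add: field_simps)
qed

text \<open>The constant 64 in \<open>q_Suc_ge\<close> makes the square root at least 8, so the
  number rounded in \<open>children\<close> is at least 2 and rounding at most halves it.\<close>

lemma children_le: "children n \<le> sqrt (q (Suc n) / q n) / 4"
  and children_ge: "children n \<ge> sqrt (q (Suc n) / q n) / 8"
  and children_ge_2: "children n \<ge> 2"
proof -
  have *: "\<lfloor>sqrt (q (Suc n) / q n) / 4\<rfloor> \<ge> 2"
    using sqrt_ratio_ge[of n] by (simp add: le_floor_iff)
  then show "children n \<ge> 2"
    unfolding children_def by linarith
  have "real (children n) = of_int \<lfloor>sqrt (q (Suc n) / q n) / 4\<rfloor>"
    using * by (simp add: children_def)
  then show "children n \<le> sqrt (q (Suc n) / q n) / 4" "children n \<ge> sqrt (q (Suc n) / q n) / 8"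
    using sqrt_ratio_ge[of n] by linarith+
qed

lemma radius_pos: "radius n > 0"
  using q_pos by (simp add: radius_def)

text \<open>Here the radius is compared with the spacing \<open>1 / q (Suc n)\<close> of the next
  level, in \<open>radius_eq'\<close> with the spacing \<open>1 / q n\<close> of its own.\<close>

lemma radius_eq: "radius n = sqrt (q (Suc n) / q n) / q (Suc n)"
  using q_pos[of n] q_pos[of "Suc n"]
  by (simp add: radius_def real_sqrt_mult real_sqrt_divide field_simps)

lemma radius_eq': "radius n = 1 / (q n * sqrt (q (Suc n) / q n))"
  using q_pos[of n] q_pos[of "Suc n"]
  by (simp add: radius_def real_sqrt_mult real_sqrt_divide field_simps)

lemma radius_le: "radius n \<le> 1 / (8 * q n)"
proof -
  have "8 * real (q n) \<le> q n * sqrt (q (Suc n) / q n)"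
    using mult_left_mono[OF sqrt_ratio_ge[of n], of "q n"] by (simp add: mult.commute)
  then show ?thesis
    unfolding radius_eq' using q_pos[of n] by (intro frac_le) auto
qed

lemma inverse_q_Suc_le: "1 / q (Suc n) \<le> radius n / 8"
  unfolding radius_eq using sqrt_ratio_ge[of n] q_pos[of "Suc n"] by (simp add: field_simps)

lemma radius_Suc_le: "radius (Suc n) \<le> radius n / 2"
  using radius_le[of "Suc n"] inverse_q_Suc_le[of n] radius_pos[of n] by simp

lemma children_radius_le: "children n / q (Suc n) \<le> radius n / 4"
  unfolding radius_eq using divide_right_mono[OF children_le[of n], of "q (Suc n)"] by (simp add: mult.commute)

lemma children_radius_ge: "radius n / 8 \<le> children n / q (Suc n)"
  unfolding radius_eq using divide_right_mono[OF children_ge[of n], of "q (Suc n)"] by (simp add: mult.commute)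

section \<open>Counting intervals and reading digits\<close>

lemma count_Suc: "count (Suc n) = children n * count n"
  by (simp add: count_def)

lemma digit_bounds:
  fixes u :: real
  shows "0 \<le> \<lfloor>count (Suc n) * u\<rfloor> - children n * \<lfloor>count n * u\<rfloor>"
  "\<lfloor>count (Suc n) * u\<rfloor> - children n * \<lfloor>count n * u\<rfloor> < children n"
  using floor_mult_digit[of "children n" "count n * u"] children_ge_2[of n]
  by (simp_all add: count_Suc mult.assoc)

lemma count_ge: "count n \<ge> 2 ^ n"
proof (induction n)
  case (Suc n)
  then show ?case
    using mult_mono[OF children_ge_2[of n] Suc] by (simp add: count_Suc)
qed (simp add: count_def)

lemma count_pos: "count n > 0"
  using count_ge[of n] by (meson less_le_trans zero_less_numeral zero_less_power)

text \<open>The lower bounds for \<open>children\<close> multiply and the ratios telescope. The loss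
  \<open>8 ^ n\<close> is later absorbed by a small power of \<open>q n\<close>.\<close>

lemma count_sqrt_ge: "sqrt (q n / q 0) \<le> 8 ^ n * real (count n)"
proof (induction n)
  case 0
  then show ?case
    using q_0_pos by (simp add: count_def)
next
  case (Suc n)
  have "sqrt (q (Suc n) / q 0) = sqrt (q (Suc n) / q n) * sqrt (q n / q 0)"
    using q_pos[of n] by (simp flip: real_sqrt_mult)
  also have "\<dots> \<le> (8 * real (children n)) * (8 ^ n * real (count n))"
    using children_ge[of n] Suc by (intro mult_mono) auto
  finally show ?case
    by (simp add: count_Suc mult_ac)
qed

text \<open>This is the nesting of consecutive intervals. Rounding moves the centre left by at most
  an eighth of the radius, the digit moves it right by at most a quarter, and the new radius is at
  most half the old one.\<close>

lemma numer_step: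
  "\<bar>numer u (Suc n) / q (Suc n) - numer u n / q n\<bar> \<le> radius n - radius (Suc n)"
proof -
  let ?x = "q (Suc n) * (numer u n / q n)"
  define D where "D = \<lfloor>count (Suc n) * u\<rfloor> - children n * \<lfloor>count n * u\<rfloor>"
  have D: "0 \<le> real_of_int D" "real_of_int D \<le> children n"
    using digit_bounds[of n u] unfolding D_def by linarith+
  have q: "real (q (Suc n)) > 0" "real (q n) > 0"
    using q_pos by auto
  have num: "real_of_int (numer u (Suc n)) = of_int \<lfloor>?x\<rfloor> + of_int D"
    by (simp add: D_def)
  have "?x - 1 \<le> numer u (Suc n)" "numer u (Suc n) \<le> ?x + children n"
    unfolding num using D of_int_floor_le[of ?x] floor_correct[of ?x] by linarith+
  then have "(?x - 1) / q (Suc n) \<le> numer u (Suc n) / q (Suc n)"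
    "numer u (Suc n) / q (Suc n) \<le> (?x + children n) / q (Suc n)"
    using q by (auto intro: divide_right_mono)
  moreover have "?x / q (Suc n) = numer u n / q n"
    using q by simp
  ultimately show ?thesis
    using inverse_q_Suc_le[of n] children_radius_le[of n] radius_Suc_le[of n] radius_pos[of n]
    unfolding diff_divide_distrib add_divide_distrib by linarith
qed

lemma point_near: "\<bar>point u - numer u n / q n\<bar> \<le> radius n"
  unfolding point_def using nested_intervals_point[of "\<lambda>n. numer u n / q n" radius n] numer_step radius_pos
  by (simp add: less_imp_le)

text \<open>The numerator starts at 0, so every point lies in the level 0 interval about 0. On so
  short an arc the circle metric is the usual distance.\<close>

lemma abs_point_le: "\<bar>point u\<bar> \<le> 1 / 8"
proof -
  have "1 / (8 * real (q 0)) \<le> 1 / 8"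
    using q_0_pos by (simp add: field_simps)
  then show ?thesis
    using point_near[of u 0] radius_le[of 0] by simp
qed

section \<open>Separation of points with different digits\<close>

lemma numer_cong:
  fixes u v :: real
  assumes "\<And>k. k \<le> n \<Longrightarrow> \<lfloor>count k * u\<rfloor> = \<lfloor>count k * v\<rfloor>"
  shows "numer u n = numer v n"
  using assms by (induction n) auto

text \<open>\<open>\<lfloor>count n * u\<rfloor>\<close> encodes the first \<open>n\<close> digits.
  At level 0 both values are 0, and they differ once
  \<open>count n * \<bar>u - v\<bar> > 1\<close>.\<close>

lemma first_difference:
  fixes u v :: real
  assumes "u \<in> {0..<1}" "v \<in> {0..<1}" "u \<noteq> v"
  obtains n where "\<And>k. k \<le> n \<Longrightarrow> \<lfloor>count k * u\<rfloor> = \<lfloor>count k * v\<rfloor>"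
    "\<lfloor>count (Suc n) * u\<rfloor> \<noteq> \<lfloor>count (Suc n) * v\<rfloor>"
proof -
  let ?P = "\<lambda>n. \<lfloor>count n * u\<rfloor> \<noteq> \<lfloor>count n * v\<rfloor>"
  have "\<exists>n. ?P n"
  proof -
    obtain n :: nat where "1 / \<bar>u - v\<bar> < 2 ^ n"
      using real_arch_pow[of 2] by auto
    also have "(2::real) ^ n \<le> real (count n)"
      using of_nat_mono[OF count_ge[of n], where 'a = real] by simp
    finally have "1 < \<bar>u - v\<bar> * count n"
      using assms(3) by (simp add: field_simps)
    also have "\<dots> = \<bar>count n * u - count n * v\<bar>"
      by (simp add: abs_mult mult.commute[of _ "real (count n)"] flip: right_diff_distrib)
    finally have "1 < \<bar>count n * u - count n * v\<bar>" .
    then have "?P n"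
      by linarith
    then show ?thesis ..
  qed
  moreover have "\<not> ?P 0"
  proof -
    have "\<lfloor>u\<rfloor> = 0" "\<lfloor>v\<rfloor> = 0"
      using assms by (simp_all add: floor_eq_iff)
    then show ?thesis
      by (simp add: count_def)
  qed
  ultimately obtain n where "\<not> ?P n" "?P (Suc n)" "\<forall>k\<le>n. \<not> ?P k"
    using ex_least_nat_less[of ?P] by (metis le_eq_less_or_eq)
  then show ?thesis
    using that[of n] by blast
qed

text \<open>At the first level of disagreement \<open>k\<close> is the difference of the digits. The
  rounded part of \<open>numer\<close> is still the same, so the centres are exactly
  \<open>k / q (Suc n)\<close> apart, and the two radii take away at most half of that.\<close>

lemma point_separated:
  fixes u v :: real
  assumes "u \<in> {0..<1}" "v \<in> {0..<1}" "u \<noteq> v"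
  obtains n k where "k > 0" "k \<le> children n" "\<bar>u - v\<bar> \<le> 2 * real k / count (Suc n)"
    "\<bar>point u - point v\<bar> \<ge> k / (2 * real (q (Suc n)))"
proof -
  obtain n where n: "\<And>k. k \<le> n \<Longrightarrow> \<lfloor>count k * u\<rfloor> = \<lfloor>count k * v\<rfloor>"
    "\<lfloor>count (Suc n) * u\<rfloor> \<noteq> \<lfloor>count (Suc n) * v\<rfloor>"
    using first_difference[OF assms] by blast
  define k where "k = nat \<bar>\<lfloor>count (Suc n) * u\<rfloor> - \<lfloor>count (Suc n) * v\<rfloor>\<bar>"
  have k_int: "int k = \<bar>\<lfloor>count (Suc n) * u\<rfloor> - \<lfloor>count (Suc n) * v\<rfloor>\<bar>"
    by (simp add: k_def)
  have k: "k > 0"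
    using n(2) by (simp add: k_def)
  have "int k \<le> children n"
    using digit_bounds[of n u] digit_bounds[of n v] unfolding k_int n(1)[OF order_refl] by linarith
  then have k_le: "k \<le> children n"
    by simp
  have k_real: "real k = \<bar>of_int \<lfloor>count (Suc n) * u\<rfloor> - of_int \<lfloor>count (Suc n) * v\<rfloor>\<bar>"
    using k_int by linarith
  have q: "real (q (Suc n)) > 0"
    using q_pos by simp
  have c: "real (count (Suc n)) > 0"
    using count_pos by simp
  have "\<bar>count (Suc n) * u - count (Suc n) * v\<bar> \<le> real k + 1"
    unfolding k_real by linarith
  also have "\<dots> \<le> 2 * real k"
    using k by simp
  finally have "count (Suc n) * \<bar>u - v\<bar> \<le> 2 * real k"
    by (simp add: abs_mult flip: right_diff_distrib)
  then have 1: "\<bar>u - v\<bar> \<le> 2 * real k / count (Suc n)"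
    using c by (simp add: field_simps)
  have "numer u (Suc n) - numer v (Suc n) = \<lfloor>count (Suc n) * u\<rfloor> - \<lfloor>count (Suc n) * v\<rfloor>"
    using numer_cong[OF n(1)] n(1)[of n] by simp
  then have "\<bar>real_of_int (numer u (Suc n)) - numer v (Suc n)\<bar> = k"
    unfolding k_real by (metis of_int_diff)
  then have "\<bar>numer u (Suc n) / q (Suc n) - numer v (Suc n) / q (Suc n)\<bar> = k / q (Suc n)"
    using q by (simp flip: diff_divide_distrib)
  then have "\<bar>point u - point v\<bar> \<ge> k / q (Suc n) - 2 * radius (Suc n)"
    using point_near[of u "Suc n"] point_near[of v "Suc n"] by linarith
  moreover have "2 * radius (Suc n) \<le> 1 / (2 * real (q (Suc n)))"
    using radius_le[of "Suc n"] q by (simp add: field_simps)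
  moreover have "1 / (2 * real (q (Suc n))) \<le> k / (2 * real (q (Suc n)))"
    using k q by (intro divide_right_mono) auto
  ultimately have "\<bar>point u - point v\<bar> \<ge> k / q (Suc n) - k / (2 * real (q (Suc n)))"
    by linarith
  then have 2: "\<bar>point u - point v\<bar> \<ge> k / (2 * real (q (Suc n)))"
    by simp
  show ?thesis
    by (rule that[OF k k_le 1 2])
qed

text \<open>Assumption \<open>radius_count\<close> is the Hoelder bound at the scale of whole
  intervals. Between two levels the fraction \<open>k / children n\<close> interpolates, with
  \<open>x \<le> x powr s\<close> for \<open>x \<le> 1\<close>.\<close>

lemma point_holder:
  fixes C s u v :: real
  assumes C: "C > 0" and s: "0 < s" "s \<le> 1"
    and radius_count: "\<And>n. 1 \<le> C * count n * radius n powr s"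
    and u: "u \<in> {0..<1}" and v: "v \<in> {0..<1}"
  shows "\<bar>u - v\<bar> \<le> 2 * C * 16 powr s * \<bar>point u - point v\<bar> powr s"
proof (cases "u = v")
  case False
  obtain n k where k: "k > 0" "k \<le> children n" and uv: "\<bar>u - v\<bar> \<le> 2 * real k / count (Suc n)"
    and xy: "\<bar>point u - point v\<bar> \<ge> k / (2 * real (q (Suc n)))"
    using point_separated[OF u v False] .
  have q: "real (q (Suc n)) > 0" and c: "real (count n) > 0" and m: "real (children n) > 0"
    using q_pos count_pos children_ge_2[of n] by auto
  let ?x = "k / children n"
  have x: "0 < ?x" "?x \<le> 1"
    using k m by auto
  have "\<bar>u - v\<bar> \<le> 2 / count n * ?x"
    using uv by (simp add: count_Suc mult.commute)
  also have "\<dots> \<le> 2 / count n * ?x powr s"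
    using x s powr_mono'[of s 1 ?x] by (intro mult_left_mono) auto
  also have "\<dots> \<le> (2 * C * radius n powr s) * ?x powr s"
    using radius_count[of n] c by (intro mult_right_mono) (auto simp: field_simps)
  \<comment> \<open>The 16 is the 8 of \<open>children_radius_ge\<close> times the 2 of
    \<open>point_separated\<close>.\<close>
  also have "\<dots> = 2 * C * 16 powr s * (radius n / 16 * ?x) powr s"
    using radius_pos[of n] x by (simp add: powr_mult powr_divide)
  also have "\<dots> \<le> 2 * C * 16 powr s * \<bar>point u - point v\<bar> powr s"
  proof (intro mult_left_mono powr_mono2)
    have "radius n / 16 * ?x \<le> children n / q (Suc n) / 2 * ?x"
      using children_radius_ge[of n] x by (intro mult_right_mono) (auto simp: mult.commute)
    also have "\<dots> = k / (2 * real (q (Suc n)))"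
      using m by simp
    finally show "radius n / 16 * ?x \<le> \<bar>point u - point v\<bar>"
      using xy by linarith
  qed (use C s x radius_pos[of n] in auto)
  finally show ?thesis .
qed (use C in simp)

end

text \<open>Once \<open>x n powr ((\<tau> - 1) * e) \<ge> b\<close>, each step multiplies
  \<open>x n powr e\<close> by at least \<open>b\<close>. This holds from \<open>n0\<close> on,
  because the factor 2 forces \<open>x n \<ge> 2 ^ n\<close>; the constant \<open>b ^ n0\<close>
  covers the earlier indices.\<close>

lemma geometric_le_powr_superexponential:
  fixes x :: "nat \<Rightarrow> real"
  assumes x0: "x 0 \<ge> 1" and x: "\<And>n. x (Suc n) \<ge> 2 * x n powr \<tau>" and \<tau>: "\<tau> > 1"
    and e: "e > 0" and b: "b \<ge> 1"
  obtains C where "C > 0" "\<And>n. b ^ n \<le> C * x n powr e"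
proof -
  have ge: "x n \<ge> 2 ^ n" for n
  proof (induction n)
    case (Suc n)
    have "x n \<ge> 1"
      using Suc one_le_power[of "2::real" n] by linarith
    then have "2 * 2 ^ n \<le> 2 * x n powr \<tau>"
      using Suc \<tau> powr_mono[of 1 \<tau> "x n"] by simp
    then show ?case
      using x[of n] by simp
  qed (use x0 in simp)
  have ge1: "x n \<ge> 1" for n
    using ge[of n] one_le_power[of "2::real" n] by linarith
  obtain n0 where n0: "b powr (1 / ((\<tau> - 1) * e)) < 2 ^ n0"
    using real_arch_pow[of 2] by auto
  have "b ^ n \<le> b ^ n0 * x n powr e" for n
  proof (induction n)
    case 0
    then show ?case
      using x0 e b one_le_power[OF b, of n0] ge_one_powr_ge_zero[of "x 0" e]
      by (simp add: mult_ge1_I)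
  next
    case (Suc n)
    show ?case
    proof (cases "Suc n \<le> n0")
      case True
      then have "b ^ Suc n \<le> b ^ n0"
        using b by (intro power_increasing)
      also have "\<dots> \<le> b ^ n0 * x (Suc n) powr e"
        using b ge1[of "Suc n"] e ge_one_powr_ge_zero[of "x (Suc n)" e] by simp
      finally show ?thesis .
    next
      case False
      then have "(2::real) ^ n0 \<le> 2 ^ n"
        by (intro power_increasing) auto
      then have "b powr (1 / ((\<tau> - 1) * e)) \<le> x n"
        using n0 ge[of n] by linarith
      then have "(b powr (1 / ((\<tau> - 1) * e))) powr ((\<tau> - 1) * e) \<le> x n powr ((\<tau> - 1) * e)"
        using \<tau> e by (intro powr_mono2) auto
      then have "b \<le> x n powr ((\<tau> - 1) * e)"
        using \<tau> e b by (simp add: powr_powr)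
      then have "b * b ^ n \<le> x n powr ((\<tau> - 1) * e) * (b ^ n0 * x n powr e)"
        using Suc b by (intro mult_mono) auto
      also have "\<dots> = b ^ n0 * (x n powr \<tau>) powr e"
        by (simp add: powr_powr algebra_simps flip: powr_add)
      also have "\<dots> \<le> b ^ n0 * x (Suc n) powr e"
        using x[of n] e b by (intro mult_left_mono powr_mono2) (auto intro: order_trans[rotated])
      finally show ?thesis
        by simp
    qed
  qed
  then show ?thesis
    using that[of "b ^ n0"] b by simp
qed

section \<open>The exponent \<open>1 / (1 + \<tau>)\<close>\<close>

context denominator_sequence
begin

lemma radius_count_bound:
  fixes K \<tau> s :: real
  assumes lower: "\<And>n. 2 * real (q n) powr \<tau> \<le> q (Suc n)"
    and upper: "\<And>n. q (Suc n) \<le> K * real (q n) powr \<tau>"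
    and K: "K > 0" and \<tau>: "\<tau> > 1" and s: "0 < s" "s < 1 / (1 + \<tau>)"
  obtains C :: real where "C > 0" "\<And>n. 1 \<le> C * count n * radius n powr s"
proof -
  \<comment> \<open>The margin left by the strict bound on \<open>s\<close>:
    \<open>s * (1 + \<tau>) / 2 = 1 / 2 - e\<close>. So \<open>radius n powr (- s)\<close> is at
    most a constant times \<open>q n powr (1 / 2 - e)\<close>, and the factor
    \<open>q n powr (- e)\<close> pays for the \<open>8 ^ n\<close> of
    \<open>count_sqrt_ge\<close>.\<close>
  define e where "e = (1 - s * (1 + \<tau>)) / 2"
  have e: "e > 0"
    using s \<tau> by (simp add: e_def field_simps)
  have "real (q 0) \<ge> 1"
    using q_0_pos by simp
  then obtain C where C: "C > 0" "\<And>n. 8 ^ n \<le> C * real (q n) powr e"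
    by (rule geometric_le_powr_superexponential[of "\<lambda>n. real (q n)" \<tau> e 8]) (use lower \<tau> e in auto)
  define C' where "C' = K powr (s / 2) * C * sqrt (q 0)"
  have "1 \<le> C' * count n * radius n powr s" for n
  proof -
    define x where "x = real (q n)"
    have x: "x > 0"
      using q_pos by (simp add: x_def)
    have "radius n = (x * q (Suc n)) powr (- 1 / 2)"
      using q_pos x by (simp add: radius_def x_def powr_minus_divide powr_half_sqrt)
    then have r: "radius n powr s = (x * q (Suc n)) powr (- s / 2)"
      by (simp add: powr_powr)
    have "x * q (Suc n) \<le> K * x powr (1 + \<tau>)"
      using mult_left_mono[OF upper[of n], of x] x by (simp add: x_def powr_add mult_ac)
    then have "(x * q (Suc n)) powr (s / 2) \<le> (K * x powr (1 + \<tau>)) powr (s / 2)"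
      using s x by (intro powr_mono2) auto
    also have "\<dots> = K powr (s / 2) * x powr (1 / 2 - e)"
      using K x by (simp add: powr_mult powr_powr e_def field_simps)
    also have "\<dots> = K powr (s / 2) * (sqrt x * x powr (- e))"
      using x powr_add[of x "1 / 2" "- e"] by (simp add: powr_half_sqrt)
    also have "\<dots> \<le> K powr (s / 2) * (sqrt (q 0) * (8 ^ n * count n) * x powr (- e))"
      using count_sqrt_ge[of n] q_0_pos
      by (intro mult_left_mono mult_right_mono) (auto simp: x_def real_sqrt_divide field_simps)
    also have "\<dots> \<le> K powr (s / 2) * (sqrt (q 0) * (C * x powr e * count n) * x powr (- e))"
      using mult_right_mono[OF C(2)[of n], of "count n"]
      by (intro mult_left_mono mult_right_mono) (auto simp: x_def)
    also have "\<dots> = C' * count n"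
      using x by (simp add: C'_def powr_minus)
    finally have "(x * q (Suc n)) powr (s / 2) * (x * q (Suc n)) powr (- s / 2)
      \<le> C' * count n * (x * q (Suc n)) powr (- s / 2)"
      by (intro mult_right_mono) auto
    then show ?thesis
      unfolding r using x q_pos[of "Suc n"] by (simp flip: powr_add)
  qed
  moreover have "C' > 0"
    using C K q_0_pos by (simp add: C'_def)
  ultimately show ?thesis
    using that by blast
qed

end

lemma F_set_parametrisation:
  fixes K \<tau> s :: real
  assumes pos: "denom \<alpha> 1 > 0"
    and lower: "\<And>n. n \<ge> 1 \<Longrightarrow> 64 * real (denom \<alpha> n) powr \<tau> \<le> denom \<alpha> (Suc n)"
    and upper: "\<And>n. n \<ge> 1 \<Longrightarrow> denom \<alpha> (Suc n) \<le> K * real (denom \<alpha> n) powr \<tau>"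
    and K: "K > 0" and \<tau>: "\<tau> > 1" and s: "0 < s" "s < 1 / (1 + \<tau>)"
  obtains \<psi> and C :: real where "C > 0" "\<And>u :: real. \<psi> u \<in> F_set \<alpha>"
    "\<And>u v. u \<in> {0..<1} \<Longrightarrow> v \<in> {0..<1} \<Longrightarrow> \<bar>u - v\<bar> \<le> C * dist (\<psi> u) (\<psi> v) powr s"
proof -
  \<comment> \<open>The index is shifted by one, since the growth bounds and the intersection in
    \<open>F_set\<close> start at 1.\<close>
  interpret denominator_sequence "\<lambda>n. denom \<alpha> (Suc n)"
  proof
    fix n
    let ?q = "denom \<alpha> (Suc n)"
    \<comment> \<open>Positivity is not yet available here; for \<open>?q = 0\<close> both sides are
      0.\<close>
    have "real ?q \<le> real ?q powr \<tau>"
      using \<tau> powr_mono[of 1 \<tau> "real ?q"] by (cases "?q = 0") auto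
    then have "real (64 * ?q) \<le> real (denom \<alpha> (Suc (Suc n)))"
      using lower[of "Suc n"] by simp
    then show "64 * ?q \<le> denom \<alpha> (Suc (Suc n))"
      by (simp only: of_nat_le_iff)
  qed (use pos in simp)
  have lower': "2 * real (denom \<alpha> (Suc n)) powr \<tau> \<le> denom \<alpha> (Suc (Suc n))" for n
    using lower[of "Suc n"] powr_ge_zero[of "real (denom \<alpha> (Suc n))" \<tau>]
    by simp
  have upper': "denom \<alpha> (Suc (Suc n)) \<le> K * real (denom \<alpha> (Suc n)) powr \<tau>" for n
    by (rule upper) simp
  obtain C :: real where C: "C > 0" "\<And>n. 1 \<le> C * count n * radius n powr s"
    by (rule radius_count_bound[OF lower' upper' K \<tau> s], rule that)
  have "s \<le> 1"
  proof -
    have "1 / (1 + \<tau>) \<le> 1"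
      using \<tau> by simp
    then show ?thesis
      using s by linarith
  qed
  show ?thesis
  proof (rule that[of "2 * C * 16 powr s" "\<lambda>u. to_circle (point u)"])
    show "2 * C * 16 powr s > 0"
      using C(1) by simp
    show "to_circle (point u) \<in> F_set \<alpha>" for u
    proof (rule to_circle_in_F_set)
      fix n :: nat
      assume "n \<ge> 1"
      then obtain k where k: "n = Suc k"
        by (metis Suc_le_D One_nat_def)
      show "denom \<alpha> n > 0"
        unfolding k by (rule q_pos)
      show "\<exists>p :: int. \<bar>point u - p / denom \<alpha> n\<bar> \<le> 1 / sqrt (real (denom \<alpha> n) * real (denom \<alpha> (n + 1)))"
        using point_near[of u k] by (auto simp: k radius_def)
    qed
    show "\<bar>u - v\<bar> \<le> 2 * C * 16 powr s * dist (to_circle (point u)) (to_circle (point v)) powr s"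
      if "u \<in> {0..<1}" "v \<in> {0..<1}" for u v
    proof -
      have "dist (to_circle (point u)) (to_circle (point v)) = \<bar>point u - point v\<bar>"
        using abs_point_le[of u] abs_point_le[of v] by (intro dist_to_circle) linarith
      then show ?thesis
        using point_holder[OF C(1) s(1) \<open>s \<le> 1\<close> C(2) that] by simp
    qed
  qed
qed

section \<open>Growth of the denominators\<close>

text \<open>Each step raises the previous constant to the power \<open>a\<close> and multiplies it
  by \<open>A\<close> or \<open>C\<close>. Below, \<open>A ^ i \<le> (A ^ i) powr a\<close> keeps
  the constant a plain power of \<open>A\<close>.\<close>

lemma iterated_powr_growth:
  fixes s :: "nat \<Rightarrow> real"
  assumes pos: "\<And>k. k \<ge> k0 \<Longrightarrow> s k > 0" and a: "a \<ge> 1" and A: "A \<ge> 1" and C: "C > 0"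
    and lower: "\<And>k. k \<ge> k0 \<Longrightarrow> A * s k powr a \<le> s (Suc k)"
    and upper: "\<And>k. k \<ge> k0 \<Longrightarrow> s (Suc k) \<le> C * s k powr a"
  obtains K where "K > 0"
    "\<And>k. k \<ge> k0 \<Longrightarrow> A ^ i * s k powr (a ^ i) \<le> s (k + i) \<and> s (k + i) \<le> K * s k powr (a ^ i)"
proof -
  have "\<exists>K>0. \<forall>k\<ge>k0. A ^ i * s k powr (a ^ i) \<le> s (k + i) \<and> s (k + i) \<le> K * s k powr (a ^ i)"
  proof (induction i)
    case 0
    show ?case
      using pos by (intro exI[of _ 1]) (simp add: less_imp_le)
  next
    case (Suc i)
    then obtain K where K: "K > 0" "\<And>k. k \<ge> k0 \<Longrightarrow> A ^ i * s k powr (a ^ i) \<le> s (k + i)"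
      "\<And>k. k \<ge> k0 \<Longrightarrow> s (k + i) \<le> K * s k powr (a ^ i)"
      by blast
    show ?case
    proof (intro exI[of _ "C * K powr a"] conjI allI impI)
      fix k
      assume k: "k \<ge> k0"
      have sk: "s k > 0" "s (k + i) > 0"
        using pos k by auto
      have "A ^ i \<le> (A ^ i) powr a"
        using a A powr_mono[of 1 a "A ^ i"] one_le_power[of A i] by simp
      then have "A ^ Suc i * s k powr (a ^ Suc i) \<le> A * ((A ^ i) powr a * (s k powr (a ^ i)) powr a)"
        using A by (simp add: powr_powr mult.assoc mult_right_mono mult.commute[of a])
      also have "\<dots> = A * (A ^ i * s k powr (a ^ i)) powr a"
        using A by (simp add: powr_mult)
      also have "\<dots> \<le> A * s (k + i) powr a"
        using A a K(2)[OF k] by (intro mult_left_mono powr_mono2) auto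
      also have "\<dots> \<le> s (k + Suc i)"
        using lower[of "k + i"] k by simp
      finally show "A ^ Suc i * s k powr (a ^ Suc i) \<le> s (k + Suc i)" .
      have "s (k + Suc i) \<le> C * s (k + i) powr a"
        using upper[of "k + i"] k by simp
      also have "\<dots> \<le> C * (K * s k powr (a ^ i)) powr a"
        using C a sk K(3)[OF k] by (intro mult_left_mono powr_mono2) auto
      also have "\<dots> = C * K powr a * s k powr (a ^ Suc i)"
        using K(1) by (simp add: powr_mult powr_powr mult.commute[of a])
      finally show "s (k + Suc i) \<le> C * K powr a * s k powr (a ^ Suc i)" .
    qed (use C K(1) in simp)
  qed
  then show ?thesis
    using that by blast
qed

lemma denom_1_pos:
  assumes "circle_rep \<alpha> \<notin> \<rat>"
  shows "denom \<alpha> 1 > 0"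
proof -
  have "0 \<le> circle_rep \<alpha>" "circle_rep \<alpha> < 1"
    by (transfer; simp add: frac_lt_1)+
  moreover have "circle_rep \<alpha> \<noteq> 0"
    using assms by auto
  ultimately have "1 / circle_rep \<alpha> \<ge> 1"
    by simp
  then have "\<lfloor>1 / circle_rep \<alpha>\<rfloor> \<ge> 1"
    by (simp add: le_floor_iff)
  then show ?thesis
    by (simp add: denom_def partial_quotient_def)
qed

text \<open>Row by row, the denominators of all coordinates form one sequence in which each term is
  comparable to the power \<open>a\<close> of its predecessor. After \<open>d\<close> steps the same
  coordinate returns with \<open>n\<close> raised by one.\<close>

lemma frakC_growth:
  assumes d: "d \<ge> 3" and a: "a > 1" and \<alpha>: "\<alpha> \<in> frakC d a"
  obtains K :: real where "K > 0" "\<And>j n. j \<in> {1..d} \<Longrightarrow> n \<ge> 1 \<Longrightarrow>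
    denom (\<alpha> j) n > 0 \<and>
    64 * real (denom (\<alpha> j) n) powr (a ^ d) \<le> denom (\<alpha> j) (Suc n) \<and>
    denom (\<alpha> j) (Suc n) \<le> K * real (denom (\<alpha> j) n) powr (a ^ d)"
proof -
  define C where "C = 2 * real_of_int \<lceil>4 powr (a + 2)\<rceil>"
  define s where "s k = real (denom (\<alpha> (Suc (k mod d))) (k div d))" for k
  have "0 < (4::real) powr (a + 2)"
    by simp
  then have C: "C > 0"
    unfolding C_def by linarith
  have bounds: "4 * s k powr a \<le> s (Suc k) \<and> s (Suc k) \<le> C * s k powr a" if k: "k \<ge> d" for k
  proof -
    have 1: "k div d \<ge> 1" "Suc (k mod d) \<in> {1..d}"
      using k d by (auto simp: Suc_le_eq div_greater_zero_iff)
    have 2: "s k = real (cyclic_denom d \<alpha> (Suc (k mod d)) (k div d))"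
      using 1(2) by (simp add: s_def cyclic_denom_def)
    \<comment> \<open>At the end of a row the successor is coordinate 1 of the next row, which is
      the convention for index \<open>d + 1\<close>.\<close>
    have 3: "s (Suc k) = real (cyclic_denom d \<alpha> (Suc (k mod d) + 1) (k div d))"
      using d by (auto simp: s_def cyclic_denom_def mod_Suc div_Suc)
    show ?thesis
      using \<alpha> 1 unfolding 2 3 C_def frakC_def by blast
  qed
  have pos: "s k > 0" if "k \<ge> d" for k
    using that
  proof (induction k rule: dec_induct)
    case base
    have "circle_rep (\<alpha> 1) \<notin> \<rat>"
      using \<alpha> d by (auto simp: frakC_def)
    then show ?case
      using denom_1_pos[of "\<alpha> 1"] d by (simp add: s_def)
  next
    case (step k)
    then have "0 < 4 * s k powr a"
      by simp
    then show ?case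
      using bounds[OF step(1)] by linarith
  qed
  obtain K where K: "K > 0"
    "\<And>k. k \<ge> d \<Longrightarrow> 4 ^ d * s k powr (a ^ d) \<le> s (k + d) \<and> s (k + d) \<le> K * s k powr (a ^ d)"
    by (rule iterated_powr_growth[of d s a 4 C d]) (use pos a C bounds in auto)
  show ?thesis
  proof (rule that[OF K(1)])
    fix j n :: nat
    assume j: "j \<in> {1..d}" and n: "n \<ge> 1"
    define k where "k = n * d + (j - 1)"
    have k: "k \<ge> d"
      using n d by (simp add: k_def trans_le_add1)
    have mods: "k mod d = j - 1" "k div d = n"
      using j d by (simp_all only: k_def mod_mult_self3 div_mult_self3) auto
    have s: "s k = real (denom (\<alpha> j) n)" "s (k + d) = real (denom (\<alpha> j) (Suc n))"
      using mods j d by (auto simp: s_def)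
    \<comment> \<open>This is where \<open>d \<ge> 3\<close> yields the constant 64 of the Cantor
      construction.\<close>
    have "(64::real) \<le> 4 ^ d"
      using power_increasing[OF d, of "4::real"] by simp
    then have "64 * s k powr (a ^ d) \<le> 4 ^ d * s k powr (a ^ d)"
      by (intro mult_right_mono) auto
    then have le: "64 * s k powr (a ^ d) \<le> s (k + d)"
      using K(2)[OF k] by linarith
    then show "denom (\<alpha> j) n > 0 \<and>
      64 * real (denom (\<alpha> j) n) powr (a ^ d) \<le> denom (\<alpha> j) (Suc n) \<and>
      denom (\<alpha> j) (Suc n) \<le> K * real (denom (\<alpha> j) n) powr (a ^ d)"
      using K(2)[OF k] pos[OF k] le unfolding s by auto
  qed
qed

theorem proposition12:
  fixes d :: nat and a :: real and \<alpha> :: "nat \<Rightarrow> circle"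
  assumes "d \<ge> 3"
    and "a > 1"
    and "2 * a ^ (d - 1) - a ^ d - 1 > 0"
    and "\<alpha> \<in> frakC d a"
    and "minimal_map (torus_topology d) (rotation d \<alpha>)"
  shows "(\<forall>j\<in>{1..d}. hausdorff_dim euclidean_metric (F_set (\<alpha> j)) \<ge> ennreal (1 / (1 + a ^ d))) \<and>
    hausdorff_dim (torus_metric d) (\<Pi>\<^sub>E j\<in>{1..d}. F_set (\<alpha> j)) \<ge> ennreal (real d / (1 + a ^ d))"
proof -
  define s0 where "s0 = 1 / (1 + a ^ d)"
  have \<tau>: "a ^ d > 1"
    using assms(1,2) by (intro one_less_power) auto
  then have s0: "s0 > 0"
    by (simp add: s0_def)
  obtain K where K: "K > 0" "\<And>j n. j \<in> {1..d} \<Longrightarrow> n \<ge> 1 \<Longrightarrow>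
    denom (\<alpha> j) n > 0 \<and>
    64 * real (denom (\<alpha> j) n) powr (a ^ d) \<le> denom (\<alpha> j) (Suc n) \<and>
    denom (\<alpha> j) (Suc n) \<le> K * real (denom (\<alpha> j) n) powr (a ^ d)"
    using frakC_growth[OF assms(1,2,4)] by blast
  have param: "\<exists>\<psi> C. C > 0 \<and> (\<forall>u. \<psi> u \<in> F_set (\<alpha> j)) \<and>
    (\<forall>u\<in>{0..<1}. \<forall>v\<in>{0..<1}. \<bar>u - v\<bar> \<le> C * dist (\<psi> u) (\<psi> v) powr s)"
    if j: "j \<in> {1..d}" and s: "0 < s" "s < s0" for j s
  proof (rule F_set_parametrisation[of "\<alpha> j" "a ^ d" K s])
    fix C :: real and \<psi> :: "real \<Rightarrow> circle"
    assume "C > 0" "\<And>u. \<psi> u \<in> F_set (\<alpha> j)"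
      "\<And>u v. u \<in> {0..<1} \<Longrightarrow> v \<in> {0..<1} \<Longrightarrow> \<bar>u - v\<bar> \<le> C * dist (\<psi> u) (\<psi> v) powr s"
    then show ?thesis
      by blast
  qed (use K(1) K(2)[OF j] \<tau> s s0_def in auto)
  have 1: "ennreal (real 1 * s0) \<le> hausdorff_dim euclidean_metric (F_set (\<alpha> j))"
    if j: "j \<in> {1..d}" for j
  proof (rule ennreal_mult_le_of_less[OF s0])
    fix s
    assume s: "0 < s" "s < s0"
    obtain \<psi> C where \<psi>: "C > 0" "\<And>u. \<psi> u \<in> F_set (\<alpha> j)"
      "\<And>u v. u \<in> {0..<1} \<Longrightarrow> v \<in> {0..<1} \<Longrightarrow> \<bar>u - v\<bar> \<le> C * dist (\<psi> u) (\<psi> v) powr s"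
      using param[OF j s] by blast
    show "ennreal (real 1 * s) \<le> hausdorff_dim euclidean_metric (F_set (\<alpha> j))"
      \<comment> \<open>The unit interval is treated as the cube over a one-point index set.\<close>
      using hausdorff_dim_ge[of "{()}" "\<lambda>u. \<psi> (u ())" "F_set (\<alpha> j)" C s euclidean_metric] \<psi> s
      by (simp add: PiE_iff)
  qed simp
  have 2: "ennreal (real d * s0) \<le> hausdorff_dim (torus_metric d) (\<Pi>\<^sub>E j\<in>{1..d}. F_set (\<alpha> j))"
  proof (rule ennreal_mult_le_of_less[OF s0])
    fix s
    assume s: "0 < s" "s < s0"
    have "\<forall>j\<in>{1..d}. \<exists>\<psi> C. C > 0 \<and> (\<forall>u. \<psi> u \<in> F_set (\<alpha> j)) \<and>
      (\<forall>u\<in>{0..<1}. \<forall>v\<in>{0..<1}. \<bar>u - v\<bar> \<le> C * dist (\<psi> u) (\<psi> v) powr s)"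
      using param[OF _ s] by blast
    then obtain \<psi> C where \<psi>: "\<And>j. j \<in> {1..d} \<Longrightarrow> C j > 0"
      "\<And>j u. j \<in> {1..d} \<Longrightarrow> \<psi> j u \<in> F_set (\<alpha> j)"
      "\<And>j u v. j \<in> {1..d} \<Longrightarrow> u \<in> {0..<1} \<Longrightarrow> v \<in> {0..<1} \<Longrightarrow>
        \<bar>u - v\<bar> \<le> C j * dist (\<psi> j u) (\<psi> j v) powr s"
      by metis
    define \<Psi> where "\<Psi> u = (\<lambda>j\<in>{1..d}. \<psi> j (u j))" for u :: "nat \<Rightarrow> real"
    define C' where "C' = (\<Sum>j\<in>{1..d}. C j)"
    have C_le: "C j \<le> C'" if "j \<in> {1..d}" for j
      unfolding C'_def using that \<psi>(1) by (intro member_le_sum) (auto simp: less_imp_le)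
    have "ennreal (card {1..d} * s) \<le> hausdorff_dim (torus_metric d) (\<Pi>\<^sub>E j\<in>{1..d}. F_set (\<alpha> j))"
    proof (rule hausdorff_dim_ge[of _ \<Psi> _ C'])
      show "\<Psi> u \<in> (\<Pi>\<^sub>E j\<in>{1..d}. F_set (\<alpha> j))" for u
        using \<psi>(2) by (simp add: \<Psi>_def)
      show "C' > 0"
        using C_le[of 1] \<psi>(1)[of 1] assms(1) by auto
      show "\<bar>u j - v j\<bar> \<le> C' * mdist (torus_metric d) (\<Psi> u) (\<Psi> v) powr s"
        if u: "u \<in> (\<Pi>\<^sub>E j\<in>{1..d}. {0..<1})" and v: "v \<in> (\<Pi>\<^sub>E j\<in>{1..d}. {0..<1})"
          and j: "j \<in> {1..d}" for u v j
      proof -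
        \<comment> \<open>A coordinate distance is at most the torus distance, so the Hoelder bound
          of each coordinate carries over to \<open>\<Psi>\<close> with the common constant
          \<open>C'\<close>.\<close>
        have "dist (\<psi> j (u j)) (\<psi> j (v j)) \<le> torus_dist d (\<Psi> u) (\<Psi> v)"
          using member_le_L2_set[of "{1..d}" j "\<lambda>j. dist (\<Psi> u j) (\<Psi> v j)"] j
          by (simp add: torus_dist_def \<Psi>_def)
        then have "C j * dist (\<psi> j (u j)) (\<psi> j (v j)) powr s
          \<le> C' * torus_dist d (\<Psi> u) (\<Psi> v) powr s"
          using C_le[OF j] \<psi>(1)[OF j] s by (intro mult_mono powr_mono2) auto
        moreover have "\<bar>u j - v j\<bar> \<le> C j * dist (\<psi> j (u j)) (\<psi> j (v j)) powr s"
          using u v j by (intro \<psi>(3)) (auto simp: PiE_iff)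
        ultimately show ?thesis
          by simp
      qed
    qed (use s in auto)
    then show "ennreal (real d * s) \<le> hausdorff_dim (torus_metric d) (\<Pi>\<^sub>E j\<in>{1..d}. F_set (\<alpha> j))"
      by simp
  qed simp
  show ?thesis
    using 1 2 by (simp add: s0_def)
qed

end
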